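(* Let $N$ be a connected 2-step nilpotent Lie group with Lie algebra $\mathfrak n$. Then $N$ is of $H$-type if and only if it is of $pH$-type; that is, $\mathfrak n$ admits a positive-definite inner product making it an algebra of $H$-type if and only if $\mathfrak n$ admits an indefinite inner product $\langle\,,\rangle$ together with choices of a complementary null subspace $\mathfrak V$ and an involution $\iota$ making it an algebra of $pH$-type.
   Context: An inner product is a nondegenerate symmetric bilinear form, not necessarily definite. Let $\mathfrak n$ be a 2-step nilpotent real Lie algebra ($[\mathfrak n,\mathfrak n]\subseteq\mathfrak z$, $\mathfrak n$ nonabelian) with center $\mathfrak z$ and inner product $\langle\,,\rangle$. Decomposition: let $\mathfrak U=\mathfrak z\cap\mathfrak z^\perp$ (the null subspace of the center). Choose a null subspace $\mathfrak V$ complementary to $\mathfrak U$, i.e. totally null, with $\dim\mathfrak V=\dim\mathfrak U$, and dually paired with $\mathfrak U$ by $\langle\,,\rangle$. Put $\mathfrak Z=\mathfrak z\cap\mathfrak U^\perp\cap\mathfrak V^\perp$ and let $\mathfrak E$ be the orthogonal complement of $\mathfrak Z$ in $\mathfrak U^\perp\cap\mathfrak V^\perp$. Then $\mathfrak n=\mathfrak U\oplus\mathfrak Z\oplus\mathfrak V\oplus\mathfrak E$, $\mathfrak z=\mathfrak U\oplus\mathfrak Z$, and $\mathfrak v:=\mathfrak V\oplus\mathfrak E$. Involution: choose a basis $\{u_i\}$ of $\mathfrak U$, the dual basis $\{v_i\}$ of $\mathfrak V$ ($\langle u_i,v_j\rangle=\delta_{ij}$), and orthonormal bases $\{z_\alpha\}$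 of $\mathfrak Z$ and $\{e_a\}$ of $\mathfrak E$ with $\langle z_\alpha,z_\alpha\rangle=\varepsilon_\alpha=\pm1$, $\langle e_a,e_a\rangle=\bar\varepsilon_a=\pm1$. Define $\iota:\mathfrak n\to\mathfrak n$ linearly by $\iota u_i=v_i$, $\iota v_i=u_i$, $\iota z_\alpha=\varepsilon_\alpha z_\alpha$, $\iota e_a=\bar\varepsilon_a e_a$. The map $j:\mathfrak U\oplus\mathfrak Z\to\operatorname{End}(\mathfrak V\oplus\mathfrak E)$ is characterized by $\langle j(a)x,\iota y\rangle=\langle[x,y],\iota a\rangle$ for $a\in\mathfrak U\oplus\mathfrak Z$, $x,y\in\mathfrak V\oplus\mathfrak E$. $\mathfrak n$ with these data (indefinite inner product) is of $pH$-type if $j(a)^2=-\langle a,\iota a\rangle I$ on $\mathfrak V\oplus\mathfrak E$ for every $a\in\mathfrak U\oplus\mathfrak Z$. When $\langle\,,\rangle$ is positive definite (so $\mathfrak U=\mathfrak V=0$, $\iota=I$), the same condition is the usual definition of $H$-type: $j(a)^2=-\langle a,a\rangle I$ on $\mathfrak z^\perp$ for all $a\in\mathfrak z$. A group is of $H$-type (resp. $pH$-type) if its Lie algebra is so for some such choice of data. *)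

theory Defs
  imports "HOL-Analysis.Analysis" "HOL-Algebra.Group"
begin

section \<open>Lie groups\<close>

text \<open>\<open>k\<close> times differentiable with continuous \<open>k\<close>-th derivatives, for maps on an open set. The
  recursion runs over directional derivatives because the type of the full derivative changes
  with its order; in finite dimension the two notions agree.\<close>

primrec C_k_on :: "nat \<Rightarrow> 'a::euclidean_space set \<Rightarrow> ('a \<Rightarrow> 'b::euclidean_space) \<Rightarrow> bool" where
  "C_k_on 0 S f \<longleftrightarrow> continuous_on S f"
| "C_k_on (Suc k) S f \<longleftrightarrow>
     (\<forall>x\<in>S. f differentiable (at x)) \<and>
     (\<forall>v. C_k_on k S (\<lambda>x. frechet_derivative f (at x) v))"

definition C_infinity_on :: "'a::euclidean_space set \<Rightarrow> ('a \<Rightarrow> 'b::euclidean_space) \<Rightarrow> bool" where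
  "C_infinity_on S f \<longleftrightarrow> open S \<and> (\<forall>k. C_k_on k S f)"

text \<open>A chart is a pair of its domain and the coordinate map; the values of the map outside the
  domain are irrelevant. The dimension of the group is the dimension of the model space \<open>'e\<close>.\<close>

type_synonym ('g, 'e) chart = "'g set \<times> ('g \<Rightarrow> 'e)"

locale lie_group = group G
  for G :: "('g, 'm) monoid_scheme" (structure) +
  fixes X :: "'g topology" and A :: "('g, 'e::euclidean_space) chart set"
  assumes topspace_eq: "topspace X = carrier G"
    and Hausdorff: "Hausdorff_space X"
    and second_countable: "second_countable X"
    and charts_cover: "(\<Union>(U, \<phi>)\<in>A. U) = carrier G"
    and chart: "\<And>U \<phi>. (U, \<phi>) \<in> A \<Longrightarrow>
      openin X U \<and> open (\<phi> ` U) \<and>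
      homeomorphic_map (subtopology X U) (top_of_set (\<phi> ` U)) \<phi>"
    and charts_compatible: "\<And>U \<phi> V \<psi>. (U, \<phi>) \<in> A \<Longrightarrow> (V, \<psi>) \<in> A \<Longrightarrow>
      C_infinity_on (\<phi> ` (U \<inter> V)) (\<lambda>x. \<psi> (inv_into U \<phi> x))"
    and mult_continuous: "continuous_map (prod_topology X X) X (\<lambda>(a, b). a \<otimes> b)"
    and inv_continuous: "continuous_map X X (\<lambda>a. m_inv G a)"
    and mult_smooth: "\<And>U \<phi> V \<psi> W \<omega>. (U, \<phi>) \<in> A \<Longrightarrow> (V, \<psi>) \<in> A \<Longrightarrow> (W, \<omega>) \<in> A \<Longrightarrow>
      C_infinity_on {(x, y). x \<in> \<phi> ` U \<and> y \<in> \<psi> ` V \<and> inv_into U \<phi> x \<otimes> inv_into V \<psi> y \<in> W}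
        (\<lambda>(x, y). \<omega> (inv_into U \<phi> x \<otimes> inv_into V \<psi> y))"
    and inv_smooth: "\<And>U \<phi> V \<psi>. (U, \<phi>) \<in> A \<Longrightarrow> (V, \<psi>) \<in> A \<Longrightarrow>
      C_infinity_on {x \<in> \<phi> ` U. m_inv G (inv_into U \<phi> x) \<in> V}
        (\<lambda>x. \<psi> (m_inv G (inv_into U \<phi> x)))"

text \<open>A chart \<open>\<phi>\<close> around the identity identifies the tangent space there with \<open>'e\<close>. In this chart
  the left-invariant vector field with value \<open>v\<close> at the identity sends \<open>x\<close> to the derivative at
  the identity, in direction \<open>v\<close>, of left translation by \<open>x\<close>. The Lie bracket of vector fields
  is \<open>[X, Y] = DY X - DX Y\<close> in coordinates; it is taken at the identity.\<close>

definition left_invariant_field ::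
    "('g, 'm) monoid_scheme \<Rightarrow> 'g set \<Rightarrow> ('g \<Rightarrow> 'e::euclidean_space) \<Rightarrow> 'e \<Rightarrow> 'e \<Rightarrow> 'e" where
  "left_invariant_field G U \<phi> v x =
     frechet_derivative (\<lambda>y. \<phi> (inv_into U \<phi> x \<otimes>\<^bsub>G\<^esub> inv_into U \<phi> y)) (at (\<phi> \<one>\<^bsub>G\<^esub>)) v"

definition chart_bracket ::
    "('g, 'm) monoid_scheme \<Rightarrow> 'g set \<Rightarrow> ('g \<Rightarrow> 'e::euclidean_space) \<Rightarrow> 'e \<Rightarrow> 'e \<Rightarrow> 'e" where
  "chart_bracket G U \<phi> s t =
     frechet_derivative (left_invariant_field G U \<phi> t) (at (\<phi> \<one>\<^bsub>G\<^esub>)) s -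
     frechet_derivative (left_invariant_field G U \<phi> s) (at (\<phi> \<one>\<^bsub>G\<^esub>)) t"

text \<open>\<open>br\<close> is the bracket of the Lie algebra of \<open>G\<close>, up to isomorphism. The isomorphism with \<open>'e\<close>
  also makes \<open>'n\<close> finite-dimensional.\<close>

definition lie_algebra_of ::
    "('g, 'm) monoid_scheme \<Rightarrow> ('g, 'e::euclidean_space) chart set \<Rightarrow>
     ('n::real_vector \<Rightarrow> 'n \<Rightarrow> 'n) \<Rightarrow> bool" where
  "lie_algebra_of G A br \<longleftrightarrow>
     (\<exists>U \<phi> T. (U, \<phi>) \<in> A \<and> \<one>\<^bsub>G\<^esub> \<in> U \<and> linear T \<and> bij T \<and>
        (\<forall>x y. T (br x y) = chart_bracket G U \<phi> (T x) (T y)))"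


section \<open>2-step nilpotent Lie algebras\<close>

locale lie_algebra =
  fixes br :: "'n::real_vector \<Rightarrow> 'n \<Rightarrow> 'n"
  assumes bilinear: "bilinear br"
    and alternating: "br x x = 0"
    and jacobi: "br x (br y z) + br y (br z x) + br z (br x y) = 0"

definition lie_center :: "('n::real_vector \<Rightarrow> 'n \<Rightarrow> 'n) \<Rightarrow> 'n set" where
  "lie_center br = {z. \<forall>x. br z x = 0}"

locale two_step_nilpotent = lie_algebra +
  assumes bracket_central: "br x y \<in> lie_center br"
    and nonabelian: "\<exists>x y. br x y \<noteq> 0"


section \<open>Inner products\<close>

definition scalar_product :: "('n::real_vector \<Rightarrow> 'n \<Rightarrow> real) \<Rightarrow> bool" where
  "scalar_product g \<longleftrightarrow>
     bilinear g \<and> (\<forall>x y. g x y = g y x) \<and> (\<forall>x. (\<forall>y. g x y = 0) \<longrightarrow> x = 0)"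

definition positive_definite :: "('n::real_vector \<Rightarrow> 'n \<Rightarrow> real) \<Rightarrow> bool" where
  "positive_definite g \<longleftrightarrow> (\<forall>x. x \<noteq> 0 \<longrightarrow> g x x > 0)"

definition indefinite :: "('n::real_vector \<Rightarrow> 'n \<Rightarrow> real) \<Rightarrow> bool" where
  "indefinite g \<longleftrightarrow> (\<exists>x. g x x > 0) \<and> (\<exists>y. g y y < 0)"

definition orth_compl :: "('n \<Rightarrow> 'n \<Rightarrow> real) \<Rightarrow> 'n set \<Rightarrow> 'n set" where
  "orth_compl g S = {x. \<forall>s\<in>S. g x s = 0}"

definition basis_family :: "nat \<Rightarrow> (nat \<Rightarrow> 'n::real_vector) \<Rightarrow> 'n set \<Rightarrow> bool" where
  "basis_family m b S \<longleftrightarrow>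
     inj_on b {..<m} \<and> independent (b ` {..<m}) \<and> span (b ` {..<m}) = S"

definition orthonormal_family :: "('n \<Rightarrow> 'n \<Rightarrow> real) \<Rightarrow> nat \<Rightarrow> (nat \<Rightarrow> 'n) \<Rightarrow> bool" where
  "orthonormal_family g m b \<longleftrightarrow>
     (\<forall>i<m. \<forall>k<m. if i = k then g (b i) (b i) \<in> {1, -1} else g (b i) (b k) = 0)"


section \<open>Decomposition and involution\<close>

definition null_center :: "('n::real_vector \<Rightarrow> 'n \<Rightarrow> 'n) \<Rightarrow> ('n \<Rightarrow> 'n \<Rightarrow> real) \<Rightarrow> 'n set" where
  "null_center br g = lie_center br \<inter> orth_compl g (lie_center br)"

definition complementary_null :: "('n::real_vector \<Rightarrow> 'n \<Rightarrow> real) \<Rightarrow> 'n set \<Rightarrow> 'n set \<Rightarrow> bool" where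
  "complementary_null g U V \<longleftrightarrow>
     subspace V \<and> (\<forall>x\<in>V. \<forall>y\<in>V. g x y = 0) \<and> dim V = dim U \<and>
     (\<forall>u\<in>U. (\<forall>v\<in>V. g u v = 0) \<longrightarrow> u = 0) \<and> (\<forall>v\<in>V. (\<forall>u\<in>U. g u v = 0) \<longrightarrow> v = 0)"

definition Z_part ::
    "('n::real_vector \<Rightarrow> 'n \<Rightarrow> 'n) \<Rightarrow> ('n \<Rightarrow> 'n \<Rightarrow> real) \<Rightarrow> 'n set \<Rightarrow> 'n set" where
  "Z_part br g V = lie_center br \<inter> orth_compl g (null_center br g) \<inter> orth_compl g V"

definition E_part ::
    "('n::real_vector \<Rightarrow> 'n \<Rightarrow> 'n) \<Rightarrow> ('n \<Rightarrow> 'n \<Rightarrow> real) \<Rightarrow> 'n set \<Rightarrow> 'n set" where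
  "E_part br g V =
     orth_compl g (null_center br g) \<inter> orth_compl g V \<inter> orth_compl g (Z_part br g V)"

definition adapted_involution ::
    "('n::real_vector \<Rightarrow> 'n \<Rightarrow> real) \<Rightarrow> 'n set \<Rightarrow> 'n set \<Rightarrow> 'n set \<Rightarrow> 'n set \<Rightarrow> ('n \<Rightarrow> 'n) \<Rightarrow> bool" where
  "adapted_involution g U Z V E \<iota> \<longleftrightarrow>
     linear \<iota> \<and>
     (\<exists>p q r u v z e.
        basis_family p u U \<and> basis_family p v V \<and>
        (\<forall>i<p. \<forall>k<p. g (u i) (v k) = (if i = k then 1 else 0)) \<and>
        basis_family q z Z \<and> orthonormal_family g q z \<and>
        basis_family r e E \<and> orthonormal_family g r e \<and>
        (\<forall>i<p. \<iota> (u i) = v i \<and> \<iota> (v i) = u i) \<and>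
        (\<forall>\<alpha><q. \<iota> (z \<alpha>) = g (z \<alpha>) (z \<alpha>) *\<^sub>R z \<alpha>) \<and>
        (\<forall>a<r. \<iota> (e a) = g (e a) (e a) *\<^sub>R e a))"


section \<open>H-type and pH-type\<close>

text \<open>The values of \<open>j_map g br \<iota> W\<close> are endomorphisms of \<open>W\<close>. For the data below the form
  \<open>\<lambda>x y. g x (\<iota> y)\<close> is positive definite on \<open>W\<close>, so the description determines
  \<open>j_map g br \<iota> W a x\<close> for \<open>x \<in> W\<close>.\<close>

definition j_map ::
    "('n \<Rightarrow> 'n \<Rightarrow> real) \<Rightarrow> ('n \<Rightarrow> 'n \<Rightarrow> 'n) \<Rightarrow> ('n \<Rightarrow> 'n) \<Rightarrow> 'n set \<Rightarrow> 'n \<Rightarrow> 'n \<Rightarrow> 'n" where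
  "j_map g br \<iota> W a x = (THE w. w \<in> W \<and> (\<forall>y\<in>W. g w (\<iota> y) = g (br x y) (\<iota> a)))"

definition H_type_wrt :: "('n::real_vector \<Rightarrow> 'n \<Rightarrow> 'n) \<Rightarrow> ('n \<Rightarrow> 'n \<Rightarrow> real) \<Rightarrow> bool" where
  "H_type_wrt br g \<longleftrightarrow>
     (let W = orth_compl g (lie_center br); j = j_map g br id W
      in \<forall>a\<in>lie_center br. \<forall>x\<in>W. j a (j a x) = - g a a *\<^sub>R x)"

definition pH_type_wrt ::
    "('n::real_vector \<Rightarrow> 'n \<Rightarrow> 'n) \<Rightarrow> ('n \<Rightarrow> 'n \<Rightarrow> real) \<Rightarrow> 'n set \<Rightarrow> ('n \<Rightarrow> 'n) \<Rightarrow> bool" where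
  "pH_type_wrt br g V \<iota> \<longleftrightarrow>
     (let U = null_center br g; Z = Z_part br g V; E = E_part br g V;
          j = j_map g br \<iota> (V + E)
      in \<forall>a\<in>U + Z. \<forall>x\<in>V + E. j a (j a x) = - g a (\<iota> a) *\<^sub>R x)"

definition H_type :: "('n::real_vector \<Rightarrow> 'n \<Rightarrow> 'n) \<Rightarrow> bool" where
  "H_type br \<longleftrightarrow> (\<exists>g. scalar_product g \<and> positive_definite g \<and> H_type_wrt br g)"

definition pH_type :: "('n::real_vector \<Rightarrow> 'n \<Rightarrow> 'n) \<Rightarrow> bool" where
  "pH_type br \<longleftrightarrow>
     (\<exists>g V \<iota>. scalar_product g \<and> indefinite g \<and>
        complementary_null g (null_center br g) V \<and>
        adapted_involution g (null_center br g) (Z_part br g V) V (E_part br g V) \<iota> \<and>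
        pH_type_wrt br g V \<iota>)"

end

theory Submission
  imports Defs
begin

text \<open>Given data of \<open>pH\<close>-type, the form \<open>\<langle>x, \<iota> y\<rangle>\<close> is positive definite, because the bases adapted
  to \<open>\<iota>\<close> form an orthonormal basis for it; with respect to this form the orthogonal complement of
  the center is \<open>\<VV> \<oplus> \<EE>\<close> and the map \<open>j\<close> is unchanged. Conversely, given a positive definite form
  of \<open>H\<close>-type, change its sign on the center. The center stays nondegenerate, so \<open>\<UU> = \<VV> = 0\<close>, the
  involution is \<open>-1\<close> on the center and \<open>1\<close> on its complement, and again \<open>j\<close> is unchanged.\<close>

section \<open>Orthonormal sets and Gram-Schmidt for a bilinear form\<close>

text \<open>Orthogonality is demanded for both orders of a pair, so the notion makes sense before
  \<open>h\<close> is known to be symmetric.\<close>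

definition orthonormal_set :: "('a::real_vector \<Rightarrow> 'a \<Rightarrow> real) \<Rightarrow> 'a set \<Rightarrow> bool" where
  "orthonormal_set h B \<longleftrightarrow>
     finite B \<and> (\<forall>b\<in>B. h b b = 1) \<and> (\<forall>b\<in>B. \<forall>c\<in>B. b \<noteq> c \<longrightarrow> h b c = 0)"

lemma bilinear_sum_scaleR_left:
  fixes h :: "'a::real_vector \<Rightarrow> 'a \<Rightarrow> real"
  assumes "bilinear h"
  shows "h (\<Sum>i\<in>I. r i *\<^sub>R b i) y = (\<Sum>i\<in>I. r i * h (b i) y)"
proof -
  have "linear (\<lambda>x. h x y)"
    using assms by (simp add: bilinear_def)
  then show ?thesis
    by (simp add: linear_sum[of "\<lambda>x. h x y"] linear_cmul[of "\<lambda>x. h x y"])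
qed

lemma bilinear_sum_scaleR_right:
  fixes h :: "'a::real_vector \<Rightarrow> 'a \<Rightarrow> real"
  assumes "bilinear h"
  shows "h y (\<Sum>i\<in>I. r i *\<^sub>R b i) = (\<Sum>i\<in>I. r i * h y (b i))"
proof -
  have "linear (h y)"
    using assms by (simp add: bilinear_def)
  then show ?thesis
    by (simp add: linear_sum linear_cmul)
qed

lemma orthonormal_set_coefficient:
  fixes h :: "'a::real_vector \<Rightarrow> 'a \<Rightarrow> real"
  assumes "bilinear h" "orthonormal_set h B" "c \<in> B"
  shows "h (\<Sum>b\<in>B. r b *\<^sub>R b) c = r c"
proof -
  have "h (\<Sum>b\<in>B. r b *\<^sub>R b) c = (\<Sum>b\<in>B. r b * h b c)"
    by (rule bilinear_sum_scaleR_left[OF assms(1)])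
  also have "\<dots> = (\<Sum>b\<in>B. if b = c then r b else 0)"
    using assms(2,3) by (intro sum.cong) (auto simp: orthonormal_set_def)
  also have "\<dots> = r c"
    using assms(2,3) by (simp add: orthonormal_set_def)
  finally show ?thesis .
qed

lemma orthonormal_set_expansion:
  fixes h :: "'a::real_vector \<Rightarrow> 'a \<Rightarrow> real"
  assumes "bilinear h" "orthonormal_set h B" "x \<in> span B"
  shows "x = (\<Sum>b\<in>B. h x b *\<^sub>R b)"
proof -
  have "finite B"
    using assms(2) by (simp add: orthonormal_set_def)
  then obtain r where r: "x = (\<Sum>b\<in>B. r b *\<^sub>R b)"
    using assms(3) by (auto simp: span_finite)
  have "h x b = r b" if "b \<in> B" for b
    unfolding r by (rule orthonormal_set_coefficient[OF assms(1,2) that])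
  then have "(\<Sum>b\<in>B. h x b *\<^sub>R b) = (\<Sum>b\<in>B. r b *\<^sub>R b)"
    by simp
  then show ?thesis
    using r by simp
qed

lemma mem_orth_compl_span:
  fixes g :: "'a::real_vector \<Rightarrow> 'a \<Rightarrow> real"
  assumes "bilinear g" "\<And>b. b \<in> B \<Longrightarrow> g x b = 0"
  shows "x \<in> orth_compl g (span B)"
proof -
  have "linear (g x)"
    using assms(1) by (simp add: bilinear_def)
  then show ?thesis
    using linear_eq_0_on_span assms(2) unfolding orth_compl_def by blast
qed

lemma orthonormal_set_residual:
  fixes h :: "'a::real_vector \<Rightarrow> 'a \<Rightarrow> real"
  assumes "bilinear h" "orthonormal_set h B"
  shows "x - (\<Sum>b\<in>B. h x b *\<^sub>R b) \<in> orth_compl h (span B)"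
  using assms
  by (intro mem_orth_compl_span) (simp_all add: bilinear_lsub orthonormal_set_coefficient)

lemma orthonormal_set_independent:
  fixes h :: "'a::real_vector \<Rightarrow> 'a \<Rightarrow> real"
  assumes "bilinear h" "orthonormal_set h B"
  shows "independent B"
proof (rule independent_if_scalars_zero)
  show "finite B"
    using assms(2) by (simp add: orthonormal_set_def)
  show "f c = 0" if "(\<Sum>b\<in>B. f b *\<^sub>R b) = 0" "c \<in> B" for f c
    using orthonormal_set_coefficient[OF assms that(2), of f] that(1)
    by (simp add: bilinear_lzero[OF assms(1)])
qed

text \<open>Expanding in \<open>B\<close> gives Parseval's formula, whose right-hand side is
  symmetric in \<open>x\<close> and \<open>y\<close> and a sum of squares for \<open>x = y\<close>.
  Symmetry thus comes out of the orthonormal basis instead of being checked by hand.\<close>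

lemma orthonormal_basis_scalar_product:
  fixes h :: "'a::real_vector \<Rightarrow> 'a \<Rightarrow> real"
  assumes bil: "bilinear h" and on: "orthonormal_set h B" and span: "span B = UNIV"
  shows "scalar_product h" "positive_definite h"
proof -
  note ex = orthonormal_set_expansion[OF bil on, unfolded span, simplified]
  have swap: "h b y = h y b" if "b \<in> B" for b y
  proof -
    have "h b y = (\<Sum>c\<in>B. h y c * h b c)"
      by (subst ex[of y]) (simp add: bilinear_sum_scaleR_right[OF bil])
    also have "\<dots> = (\<Sum>c\<in>B. if c = b then h y c else 0)"
      using on that by (intro sum.cong) (auto simp: orthonormal_set_def)
    also have "\<dots> = h y b"
      using on that by (simp add: orthonormal_set_def)
    finally show ?thesis .
  qed
  have parseval: "h x y = (\<Sum>b\<in>B. h x b * h y b)" for x y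
  proof -
    have "h x y = (\<Sum>b\<in>B. h x b * h b y)"
      by (subst ex[of x]) (simp add: bilinear_sum_scaleR_left[OF bil])
    also have "\<dots> = (\<Sum>b\<in>B. h x b * h y b)"
      using swap by (metis (no_types, lifting) sum.cong)
    finally show ?thesis .
  qed
  have sym: "h x y = h y x" for x y
    unfolding parseval[of x y] parseval[of y x] by (simp add: mult.commute)
  show pd: "positive_definite h"
    unfolding positive_definite_def
  proof (intro allI impI)
    fix x :: 'a
    assume "x \<noteq> 0"
    \<comment> \<open>If every coefficient vanished, the expansion would give
      \<open>x = 0\<close>.\<close>
    then obtain b where b: "b \<in> B" "h x b \<noteq> 0"
      using ex[of x] by (metis (no_types, lifting) scaleR_zero_left sum.neutral)
    have "0 < (\<Sum>b\<in>B. h x b * h x b)"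
      using on b by (intro sum_pos2[of B b])
        (auto simp: orthonormal_set_def zero_less_mult_iff linorder_neq_iff)
    then show "h x x > 0"
      using parseval[of x x] by simp
  qed
  have "x = 0" if "\<And>y. h x y = 0" for x
    using pd that[of x] unfolding positive_definite_def by (metis less_irrefl)
  then show "scalar_product h"
    unfolding scalar_product_def using bil sym by blast
qed

text \<open>The inductive step subtracts from \<open>x\<close> its projection on
  \<open>span B\<close>. A zero residual adds nothing to the span; otherwise the normalized residual
  joins \<open>B\<close>.\<close>

lemma gram_schmidt:
  fixes h :: "'a::real_vector \<Rightarrow> 'a \<Rightarrow> real"
  assumes sp: "scalar_product h" and pd: "positive_definite h" and "finite F"
  shows "\<exists>B. orthonormal_set h B \<and> span B = span F"
  using \<open>finite F\<close>
proof induction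
  case empty
  then show ?case
    by (intro exI[of _ "{}"]) (simp add: orthonormal_set_def)
next
  case (insert x F)
  have bil: "bilinear h" and sym: "\<And>x y. h x y = h y x"
    using sp by (auto simp: scalar_product_def)
  obtain B where B: "orthonormal_set h B" "span B = span F"
    using insert.IH by blast
  define p where "p = (\<Sum>b\<in>B. h x b *\<^sub>R b)"
  define y where "y = x - p"
  have p: "p \<in> span B"
    unfolding p_def by (intro span_sum span_scale span_base)
  have perp: "h y s = 0" if "s \<in> span B" for s
    using orthonormal_set_residual[OF bil B(1), of x] that
    by (simp add: y_def p_def orth_compl_def)
  have x: "x = p + y"
    by (simp add: y_def)
  \<comment> \<open>Exchange of \<open>x\<close> for a new vector \<open>c\<close>: it suffices that
    each of the two lies in the span of \<open>B\<close> and the other.\<close>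
  have eq: "span (insert x F) = span (insert c B)"
    if "c \<in> span (insert x B)" "x \<in> span (insert c B)" for c
  proof -
    have "span (insert x F) = span (insert x B)"
      using B(2) by (simp add: span_insert)
    also have "\<dots> = span (insert c B)"
      unfolding span_eq using that by (auto intro: span_base)
    finally show ?thesis .
  qed
  show ?case
  proof (cases "y = 0")
    case True
    then have "x \<in> span B"
      using p x by simp
    then show ?thesis
      using B by (metis span_redundant)
  next
    case False
    then have pos: "h y y > 0"
      using pd by (simp add: positive_definite_def)
    define c where "c = (1 / sqrt (h y y)) *\<^sub>R y"
    have cc: "h c c = 1"
      using pos by (simp add: c_def bilinear_lmul[OF bil] bilinear_rmul[OF bil])
    have "h c b = 0" "h b c = 0" if "b \<in> B" for b
      using perp[OF span_base[OF that]] sym[of b c] by (simp_all add: c_def bilinear_lmul[OF bil])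
    then have "orthonormal_set h (insert c B)"
      using B(1) cc by (auto simp: orthonormal_set_def)
    moreover have "span (insert x F) = span (insert c B)"
    proof (rule eq)
      have p': "p \<in> span (insert d B)" for d
        using p span_mono[of B "insert d B"] by blast
      show "c \<in> span (insert x B)"
        unfolding c_def y_def by (intro span_scale span_diff p' span_base insertI1)
      have y: "y = sqrt (h y y) *\<^sub>R c"
        using pos by (simp add: c_def)
      have "y \<in> span (insert c B)"
        by (subst y) (intro span_scale span_base, simp)
      with p' show "x \<in> span (insert c B)"
        unfolding x by (intro span_add)
    qed
    ultimately show ?thesis
      by blast
  qed
qed

text \<open>The set \<open>F\<close> expresses finite dimension: it bounds a maximal independent
  subset of \<open>S\<close>, to which Gram-Schmidt then applies.\<close>

lemma orthonormal_basis_exists: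
  fixes h :: "'a::real_vector \<Rightarrow> 'a \<Rightarrow> real" and F :: "'a set"
  assumes "scalar_product h" "positive_definite h" "subspace S" and F: "finite F" "span F = UNIV"
  shows "\<exists>B. orthonormal_set h B \<and> span B = S"
proof -
  obtain C where C: "C \<subseteq> S" "independent C" "S \<subseteq> span C"
    using maximal_independent_subset by metis
  have "finite C"
    using independent_span_bound[OF F(1) C(2)] F(2) by simp
  moreover have "span C = S"
    using C assms(3) by (simp add: span_minimal subset_antisym)
  ultimately show ?thesis
    using gram_schmidt[OF assms(1,2)] by metis
qed

text \<open>Enumerates an orthonormal set, to produce the indexed bases that
  \<open>adapted_involution\<close> asks for.\<close>

lemma orthonormal_set_basis_family:
  fixes h :: "'a::real_vector \<Rightarrow> 'a \<Rightarrow> real"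
  assumes "bilinear h" "orthonormal_set h B"
  obtains m b where "basis_family m b (span B)"
    "\<And>i k. i < m \<Longrightarrow> k < m \<Longrightarrow> h (b i) (b k) = (if i = k then 1 else 0)" "b ` {..<m} = B"
proof -
  have "finite B"
    using assms(2) by (simp add: orthonormal_set_def)
  then obtain b where b: "bij_betw b {..<card B} B"
    using ex_bij_betw_nat_finite by (metis atLeast0LessThan)
  then have im: "b ` {..<card B} = B" and inj: "inj_on b {..<card B}"
    by (auto simp: bij_betw_def)
  show ?thesis
  proof
    show "basis_family (card B) b (span B)"
      using inj im orthonormal_set_independent[OF assms] by (simp add: basis_family_def)
    show "h (b i) (b k) = (if i = k then 1 else 0)" if "i < card B" "k < card B" for i k
    proof -
      have "b i \<in> B" "b k \<in> B"
        using that im by auto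
      then show ?thesis
        using assms(2) inj_onD[OF inj, of i k] that by (auto simp: orthonormal_set_def)
    qed
    show "b ` {..<card B} = B"
      by (rule im)
  qed
qed

lemma subspace_lie_center:
  assumes "bilinear br"
  shows "subspace (lie_center br)"
  by (auto simp: subspace_def lie_center_def bilinear_lzero[OF assms] bilinear_ladd[OF assms]
      bilinear_lmul[OF assms])

lemma subspace_orth_compl:
  fixes g :: "'a::real_vector \<Rightarrow> 'a \<Rightarrow> real"
  assumes "bilinear g"
  shows "subspace (orth_compl g S)"
  by (auto simp: subspace_def orth_compl_def bilinear_lzero[OF assms] bilinear_ladd[OF assms]
      bilinear_lmul[OF assms])

lemma orth_compl_zero:
  fixes g :: "'a::real_vector \<Rightarrow> 'a \<Rightarrow> real"
  assumes "bilinear g"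
  shows "orth_compl g {0} = UNIV"
  by (simp add: orth_compl_def bilinear_rzero[OF assms])

lemma bilinear_compose_right:
  assumes "bilinear g" "linear f"
  shows "bilinear (\<lambda>x y. g x (f y))"
  using assms linear_compose[OF assms(2), unfolded o_def]
  by (auto simp: bilinear_def)

section \<open>From H-type to pH-type\<close>

lemma H_type_imp_pH_type:
  fixes br :: "'n::real_vector \<Rightarrow> 'n \<Rightarrow> 'n" and F :: "'n set"
  assumes nil: "two_step_nilpotent br" and F: "finite F" "span F = UNIV" and "H_type br"
  shows "pH_type br"
proof -
  obtain g where sp: "scalar_product g" and pd: "positive_definite g" and H: "H_type_wrt br g"
    using assms(4) by (auto simp: H_type_def)
  have bil: "bilinear g" and sym: "\<And>x y. g x y = g y x"
    using sp by (auto simp: scalar_product_def)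
  have brbil: "bilinear br"
    using nil by (simp add: two_step_nilpotent_def lie_algebra_def)
  define C where "C = lie_center br"
  define W where "W = orth_compl g C"
  have subC: "subspace C" and subW: "subspace W"
    unfolding C_def W_def
    using subspace_lie_center[OF brbil] subspace_orth_compl[OF bil] by auto
  obtain B where B: "orthonormal_set g B" "span B = C"
    using orthonormal_basis_exists[OF sp pd subC F] by blast
  obtain D where D: "orthonormal_set g D" "span D = W"
    using orthonormal_basis_exists[OF sp pd subW F] by blast
  \<comment> \<open>\<open>P\<close> is the orthogonal projection onto the center and
    \<open>\<iota>\<close> the reflection that is -1 on \<open>C\<close> and 1 on \<open>W\<close>,
    so \<open>g'\<close> is \<open>g\<close> with its sign changed on the center.\<close>
  define P where "P = (\<lambda>x. \<Sum>b\<in>B. g x b *\<^sub>R b)"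
  define \<iota> where "\<iota> = (\<lambda>x. x - 2 *\<^sub>R P x)"
  define g' where "g' = (\<lambda>x y. g x (\<iota> y))"
  have linP: "linear P"
    unfolding P_def
    by (rule linearI)
      (simp_all add: bilinear_ladd[OF bil] bilinear_lmul[OF bil] scaleR_add_left sum.distrib
        scaleR_sum_right)
  have lin: "linear \<iota>"
    unfolding \<iota>_def
    by (rule linearI) (simp_all add: linear_add[OF linP] linear_cmul[OF linP] algebra_simps)
  have bil': "bilinear g'"
    unfolding g'_def by (rule bilinear_compose_right[OF bil lin])
  have PC: "P x \<in> C" for x
    unfolding P_def B(2)[symmetric] by (intro span_sum span_scale span_base)
  have PW: "x - P x \<in> W" for x
    using orthonormal_set_residual[OF bil B(1)] by (simp add: W_def P_def B(2))
  have "P x = x" if "x \<in> C" for x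
    using orthonormal_set_expansion[OF bil B(1), unfolded B(2), OF that] by (simp add: P_def)
  then have \<iota>C: "\<iota> x = - x" if "x \<in> C" for x
    using that by (simp add: \<iota>_def scaleR_2)
  have P0: "P x = 0" if "x \<in> W" for x
    unfolding P_def
  proof (intro sum.neutral ballI)
    fix b assume "b \<in> B"
    then have "b \<in> C"
      using B(2) by (metis span_base)
    then show "g x b *\<^sub>R b = 0"
      using that by (simp add: W_def orth_compl_def)
  qed
  then have \<iota>W: "\<iota> x = x" if "x \<in> W" for x
    using that by (simp add: \<iota>_def)
  \<comment> \<open>\<open>P\<close> kills \<open>x - P x\<close>, which lies in \<open>W\<close>.
    Idempotence makes \<open>\<iota>\<close> an involution.\<close>
  have "P (P x) = P x" for x
    using P0[OF PW[of x]] by (simp add: linear_diff[OF linP])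
  then have \<iota>\<iota>: "\<iota> (\<iota> x) = x" for x
    by (simp add: \<iota>_def linear_diff[OF linP] linear_add[OF linP] scaleR_2)
  have selfadj: "g (P x) y = g x (P y)" for x y
    unfolding P_def bilinear_sum_scaleR_left[OF bil] bilinear_sum_scaleR_right[OF bil]
    by (metis (no_types, lifting) mult.commute sym)
  have sym': "g' x y = g' y x" for x y
    using selfadj[of x y] sym[of x y] sym[of "P x" y] unfolding g'_def \<iota>_def
    by (simp add: bilinear_rsub[OF bil] bilinear_rmul[OF bil])
  have g'\<iota>: "g' x (\<iota> y) = g x y" for x y
    by (simp add: g'_def \<iota>\<iota>)
  have pos: "g x x > 0" if "x \<noteq> 0" for x
    using pd that by (simp add: positive_definite_def)
  \<comment> \<open>Nondegeneracy: pairing \<open>x\<close> with \<open>\<iota> x\<close> under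
    \<open>g'\<close> gives \<open>g x x\<close>, which is positive unless
    \<open>x = 0\<close>.\<close>
  have sp': "scalar_product g'"
    unfolding scalar_product_def using bil' sym' g'\<iota> pos by (metis less_irrefl)
  have "\<exists>x y. br x y \<noteq> 0" and cen: "\<And>x y. br x y \<in> C"
    using nil by (auto simp: C_def two_step_nilpotent_def two_step_nilpotent_axioms_def)
  then obtain x y where xy: "br x y \<noteq> 0"
    by blast
  \<comment> \<open>A nonzero bracket \<open>br x y\<close> serves twice: it is central, hence
    negative for \<open>g'\<close>, and it shows that \<open>x\<close> is not central, so the
    component of \<open>x\<close> in \<open>W\<close> is nonzero and positive.\<close>
  have "indefinite g'"
    unfolding indefinite_def
  proof
    have "g' (br x y) (br x y) < 0"
      using pos[OF xy] by (simp add: g'_def \<iota>C[OF cen] bilinear_rneg[OF bil])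
    then show "\<exists>y. g' y y < 0"
      by blast
    have "x \<notin> C"
      using xy by (auto simp: C_def lie_center_def)
    then have "x - P x \<noteq> 0"
      using PC[of x] by auto
    then have "g' (x - P x) (x - P x) > 0"
      using pos by (simp add: g'_def \<iota>W[OF PW])
    then show "\<exists>x. g' x x > 0"
      by blast
  qed
  have W': "orth_compl g' C = W"
    by (auto simp: orth_compl_def W_def g'_def \<iota>C bilinear_rneg[OF bil])
  have U: "null_center br g' = {0}"
  proof -
    have "x = 0" if "x \<in> C" "x \<in> W" for x
      using that pos[of x] by (auto simp: W_def orth_compl_def)
    then show ?thesis
      using subspace_0[OF subC] subspace_0[OF subW]
      unfolding null_center_def C_def[symmetric] W' by auto
  qed
  have Z: "Z_part br g' {0} = C"
    by (simp add: Z_part_def U orth_compl_zero[OF bil'] C_def)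
  have E: "E_part br g' {0} = W"
    by (simp add: E_part_def U orth_compl_zero[OF bil'] Z W')
  have "complementary_null g' (null_center br g') {0}"
    by (simp add: U complementary_null_def bilinear_rzero[OF bil'])
  moreover have "adapted_involution g' {0} C {0} W \<iota>"
  proof -
    obtain q z where z: "basis_family q z C"
      "\<And>i k. i < q \<Longrightarrow> k < q \<Longrightarrow> g (z i) (z k) = (if i = k then 1 else 0)" "z ` {..<q} = B"
      using orthonormal_set_basis_family[OF bil B(1)] B(2) by metis
    obtain r e where e: "basis_family r e W"
      "\<And>i k. i < r \<Longrightarrow> k < r \<Longrightarrow> g (e i) (e k) = (if i = k then 1 else 0)" "e ` {..<r} = D"
      using orthonormal_set_basis_family[OF bil D(1)] D(2) by metis
    have zC: "z i \<in> C" if "i < q" for i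
      using that z(3) B(2) span_base[of "z i" B] by auto
    have eW: "e i \<in> W" if "i < r" for i
      using that e(3) D(2) span_base[of "e i" D] by auto
    have gz: "g' (z i) (z k) = (if i = k then -1 else 0)" if "i < q" "k < q" for i k
      using that by (simp add: g'_def \<iota>C zC bilinear_rneg[OF bil] z(2))
    have ge: "g' (e i) (e k) = (if i = k then 1 else 0)" if "i < r" "k < r" for i k
      using that by (simp add: g'_def \<iota>W eW e(2))
    \<comment> \<open>The empty family is a basis of the zero space, whatever \<open>u\<close> is;
      the constant families chosen below for the two null subspaces are placeholders.\<close>
    have triv: "basis_family 0 u {0}" for u :: "nat \<Rightarrow> 'n"
      by (simp add: basis_family_def independent_empty)
    have on: "orthonormal_family g' q z" "orthonormal_family g' r e"
      by (simp_all add: orthonormal_family_def gz ge)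
    have sc: "\<forall>i<q. \<iota> (z i) = g' (z i) (z i) *\<^sub>R z i" "\<forall>i<r. \<iota> (e i) = g' (e i) (e i) *\<^sub>R e i"
      by (simp_all add: gz ge \<iota>C \<iota>W zC eW)
    show ?thesis
      unfolding adapted_involution_def
      by (rule conjI[OF lin], rule exI[of _ 0], rule exI[of _ q], rule exI[of _ r],
          rule exI[of _ "\<lambda>_. 0"], rule exI[of _ "\<lambda>_. 0"], rule exI[of _ z], rule exI[of _ e])
        (simp add: triv z(1) e(1) on sc)
  qed
  moreover have "pH_type_wrt br g' {0} \<iota>"
  proof -
    have zero: "{0} + S = S" for S :: "'n set"
      by (auto simp: set_plus_def)
    \<comment> \<open>Since \<open>g' x (\<iota> y) = g x y\<close>, both maps have the same
      defining equation, and the scalar \<open>g' a (\<iota> a)\<close> is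
      \<open>g a a\<close>.\<close>
    have "j_map g' br \<iota> W = j_map g br id W"
      by (simp add: j_map_def g'\<iota> fun_eq_iff)
    then show ?thesis
      using H unfolding pH_type_wrt_def H_type_wrt_def U Z E zero Let_def
      by (simp add: C_def[symmetric] W_def[symmetric] g'\<iota>)
  qed
  ultimately show ?thesis
    using sp' \<open>indefinite g'\<close> U Z E unfolding pH_type_def by metis
qed

section \<open>From pH-type to H-type\<close>

text \<open>Passing to \<open>h\<close> absorbs \<open>\<iota>\<close> both in the equation defining
  \<open>j_map\<close> and in the scalar \<open>g a (\<iota> a)\<close>. What remains is to identify
  the center with \<open>U + Z\<close> and its \<open>h\<close>-complement with
  \<open>V + E\<close>; the adapted bases supply the finite dimension.\<close>

lemma pH_type_imp_H_type:
  fixes br :: "'n::real_vector \<Rightarrow> 'n \<Rightarrow> 'n"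
  assumes brbil: "bilinear br" and "pH_type br"
  shows "H_type br"
proof -
  define C where "C = lie_center br"
  have subC: "subspace C"
    unfolding C_def by (rule subspace_lie_center[OF brbil])
  obtain g V \<iota> where sp: "scalar_product g"
    and comp: "complementary_null g (null_center br g) V"
    and adap: "adapted_involution g (null_center br g) (Z_part br g V) V (E_part br g V) \<iota>"
    and pH: "pH_type_wrt br g V \<iota>"
    using assms(2) unfolding pH_type_def by blast
  have bil: "bilinear g" and sym: "\<And>x y. g x y = g y x"
    using sp by (auto simp: scalar_product_def)
  define U where "U = null_center br g"
  define Z where "Z = Z_part br g V"
  define E where "E = E_part br g V"
  define h where "h = (\<lambda>x y. g x (\<iota> y))"
  obtain p q r u v z e where lin: "linear \<iota>"
    and u: "basis_family p u U" and v: "basis_family p v V"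
    and dual: "\<forall>i<p. \<forall>k<p. g (u i) (v k) = (if i = k then 1 else 0)"
    and z: "basis_family q z Z" "orthonormal_family g q z"
    and e: "basis_family r e E" "orthonormal_family g r e"
    and swap: "\<forall>i<p. \<iota> (u i) = v i \<and> \<iota> (v i) = u i"
    and \<iota>z: "\<forall>i<q. \<iota> (z i) = g (z i) (z i) *\<^sub>R z i"
    and \<iota>e: "\<forall>i<r. \<iota> (e i) = g (e i) (e i) *\<^sub>R e i"
    using adap unfolding adapted_involution_def U_def[symmetric] Z_def[symmetric] E_def[symmetric]
    by (elim conjE exE) (rule that)
  have uv: "g (u i) (v k) = (if i = k then 1 else 0)" if "i < p" "k < p" for i k
    using dual that by blast
  have \<iota>u: "\<iota> (u i) = v i" and \<iota>v: "\<iota> (v i) = u i" if "i < p" for i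
    using swap that by auto
  have vu: "g (v k) (u i) = (if i = k then 1 else 0)" if "i < p" "k < p" for i k
    using uv[OF that] sym[of "u i" "v k"] by simp
  have bilh: "bilinear h"
    unfolding h_def by (rule bilinear_compose_right[OF bil lin])
  have spans: "span (u ` {..<p}) = U" "span (v ` {..<p}) = V" "span (z ` {..<q}) = Z"
    "span (e ` {..<r}) = E"
    using u v z e by (simp_all add: basis_family_def)
  then have sub: "subspace U" "subspace V" "subspace Z" "subspace E"
    using subspace_span by metis+
  have mem: "i < p \<Longrightarrow> u i \<in> U" "i < p \<Longrightarrow> v i \<in> V" "j < q \<Longrightarrow> z j \<in> Z" "k < r \<Longrightarrow> e k \<in> E" for i j k
    unfolding spans[symmetric] by (auto intro!: span_base)
  have UC: "U \<subseteq> C" and ZC: "Z \<subseteq> C"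
    by (auto simp: U_def Z_def C_def null_center_def Z_part_def)
  \<comment> \<open>\<open>U\<close> is orthogonal to the whole center, in particular to itself and
    to \<open>Z\<close>.\<close>
  have CU: "g x y = 0" "g y x = 0" if "x \<in> C" "y \<in> U" for x y
    using that sym[of x y] by (auto simp: U_def C_def null_center_def orth_compl_def)
  have VV: "g x y = 0" if "x \<in> V" "y \<in> V" for x y
    using comp that by (simp add: complementary_null_def)
  have ZV: "g x y = 0" "g y x = 0" if "x \<in> Z" "y \<in> V" for x y
    using that sym[of x y] by (auto simp: Z_def Z_part_def orth_compl_def)
  have EU: "g x y = 0" "g y x = 0" if "x \<in> E" "y \<in> U" for x y
    using that sym[of x y] by (auto simp: U_def E_def E_part_def orth_compl_def)
  have EV: "g x y = 0" "g y x = 0" if "x \<in> E" "y \<in> V" for x y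
    using that sym[of x y] by (auto simp: E_def E_part_def orth_compl_def)
  have EZ: "g x y = 0" "g y x = 0" if "x \<in> E" "y \<in> Z" for x y
    using that sym[of x y] by (auto simp: Z_def E_def E_part_def orth_compl_def)
  have UU: "g x y = 0" if "x \<in> U" "y \<in> U" for x y
    using that CU UC by blast
  have UZ: "g x y = 0" "g y x = 0" if "x \<in> U" "y \<in> Z" for x y
    using that CU ZC by blast+
  have orth_U: "x \<in> orth_compl g U" if "\<And>i. i < p \<Longrightarrow> g x (u i) = 0" for x
    unfolding spans(1)[symmetric] by (rule mem_orth_compl_span[OF bil]) (use that in auto)
  have orth_V: "x \<in> orth_compl g V" if "\<And>i. i < p \<Longrightarrow> g x (v i) = 0" for x
    unfolding spans(2)[symmetric] by (rule mem_orth_compl_span[OF bil]) (use that in auto)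
  have orth_Z: "x \<in> orth_compl g Z" if "\<And>i. i < q \<Longrightarrow> g x (z i) = 0" for x
    unfolding spans(3)[symmetric] by (rule mem_orth_compl_span[OF bil]) (use that in auto)
  \<comment> \<open>Coefficients along \<open>u\<close> are read off with the dual basis
    \<open>v\<close>, and conversely. In \<open>pZ\<close> the factor \<open>g (z i) (z i)\<close>
    is a sign, hence its own inverse, and corrects for vectors of square -1.\<close>
  define pU where "pU = (\<lambda>x. \<Sum>i<p. g x (v i) *\<^sub>R u i)"
  define pV where "pV = (\<lambda>x. \<Sum>i<p. g x (u i) *\<^sub>R v i)"
  define pZ where "pZ = (\<lambda>x. \<Sum>i<q. (g x (z i) * g (z i) (z i)) *\<^sub>R z i)"
  have pU: "pU x \<in> U" and pV: "pV x \<in> V" and pZ: "pZ x \<in> Z" for x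
    unfolding pU_def pV_def pZ_def
    by (auto intro!: subspace_sum subspace_scale sub mem)
  have pUv: "g (pU x) (v k) = g x (v k)" and pVu: "g (pV x) (u k) = g x (u k)" if "k < p" for k x
    using that unfolding pU_def pV_def
    by (simp_all add: bilinear_sum_scaleR_left[OF bil] uv vu if_distrib
        cong: if_cong)
  have zz: "g (z i) (z i) * g (z i) (z i) = 1" "i \<noteq> k \<Longrightarrow> g (z i) (z k) = 0"
    if "i < q" "k < q" for i k
    using z(2) that unfolding orthonormal_family_def by force+
  have ee: "g (e i) (e i) * g (e i) (e i) = 1" "i \<noteq> k \<Longrightarrow> g (e i) (e k) = 0"
    if "i < r" "k < r" for i k
    using e(2) that unfolding orthonormal_family_def by force+
  have pZz: "g (pZ x) (z k) = g x (z k)" if "k < q" for k x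
  proof -
    have "g (pZ x) (z k) = (\<Sum>i<q. g x (z i) * g (z i) (z i) * g (z i) (z k))"
      unfolding pZ_def by (simp add: bilinear_sum_scaleR_left[OF bil])
    also have "\<dots> = (\<Sum>i<q. if i = k then g x (z i) else 0)"
      using that zz by (intro sum.cong) (auto simp: mult.assoc)
    finally show ?thesis
      using that by simp
  qed
  \<comment> \<open>\<open>y x\<close> is the component of \<open>x\<close> orthogonal to
    \<open>U\<close> and \<open>V\<close>; removing its part in \<open>Z\<close> leaves a vector
    satisfying the orthogonality conditions that define \<open>E\<close>.\<close>
  define y where "y = (\<lambda>x. x - pU x - pV x)"
  have yUV: "y x \<in> orth_compl g U" "y x \<in> orth_compl g V" for x
    unfolding y_def
    by (auto intro!: orth_U orth_V simp: bilinear_lsub[OF bil] pUv pVu UU VV pU pV mem)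
  have yE: "y x - pZ (y x) \<in> E" for x
  proof -
    have "y x - pZ (y x) \<in> orth_compl g Z"
      by (intro orth_Z) (simp add: bilinear_lsub[OF bil] pZz)
    moreover have "y x - pZ (y x) \<in> orth_compl g U" "y x - pZ (y x) \<in> orth_compl g V"
      using yUV[of x] pZ[of "y x"] by (auto simp: orth_compl_def bilinear_lsub[OF bil] UZ ZV)
    ultimately show ?thesis
      by (simp add: E_def E_part_def U_def Z_def)
  qed
  \<comment> \<open>The first bracket lies in \<open>U + Z\<close>, the second in
    \<open>V + E\<close>.\<close>
  have decomp: "x = (pU x + pZ (y x)) + (pV x + (y x - pZ (y x)))" for x
    by (simp add: y_def algebra_simps)
  have C_eq: "U + Z = C"
  proof
    show "U + Z \<subseteq> C"
      using UC ZC subspace_add[OF subC] by (auto simp: set_plus_def)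
    show "C \<subseteq> U + Z"
    proof
      \<comment> \<open>A central vector is orthogonal to \<open>U\<close>, so it has no component
        in \<open>V\<close>. Then \<open>y x\<close> is itself central and lies in
        \<open>Z\<close>.\<close>
      fix x assume x: "x \<in> C"
      then have "pV x = 0"
        by (simp add: pV_def CU mem)
      then have y: "y x = x - pU x"
        by (simp add: y_def)
      then have "y x \<in> C"
        using x pU UC subspace_diff[OF subC] by auto
      then have "y x \<in> Z"
        using yUV[of x] by (simp add: Z_def Z_part_def C_def U_def)
      moreover have "x = pU x + y x"
        using y by simp
      ultimately show "x \<in> U + Z"
        using pU by (metis set_plus_intro)
    qed
  qed
  define B where "B = u ` {..<p} \<union> v ` {..<p} \<union> z ` {..<q} \<union> e ` {..<r}"
  have "span B = UNIV"
  proof -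
    have S: "U \<subseteq> span B" "V \<subseteq> span B" "Z \<subseteq> span B" "E \<subseteq> span B"
      using spans by (auto simp: B_def intro: span_mono[THEN subsetD, rotated])
    have "x \<in> span B" for x
      by (subst decomp) (intro span_add S[THEN subsetD] pU pV pZ yE)
    then show ?thesis
      by auto
  qed
  moreover have "orthonormal_set h B"
  proof -
    \<comment> \<open>Pairing by \<open>h\<close> with a basis vector is pairing by \<open>g\<close>
      with its image under \<open>\<iota>\<close>: the dual partner for \<open>u\<close> and
      \<open>v\<close>, a signed copy for \<open>z\<close> and \<open>e\<close>. Duality and squared
      signs then give \<open>h b b = 1\<close>.\<close>
    have hu: "h x (u i) = g x (v i)" "h x (v i) = g x (u i)" if "i < p" for x i
      using that by (simp_all add: h_def \<iota>u \<iota>v)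
    have hz: "h x (z i) = g (z i) (z i) * g x (z i)" if "i < q" for x i
      using that by (simp add: h_def \<iota>z bilinear_rmul[OF bil])
    have he: "h x (e i) = g (e i) (e i) * g x (e i)" if "i < r" for x i
      using that by (simp add: h_def \<iota>e bilinear_rmul[OF bil])
    have "\<forall>b\<in>B. h b b = 1"
      unfolding B_def by (auto simp: hu hz he uv vu zz ee)
    moreover have "\<forall>b\<in>B. \<forall>c\<in>B. b \<noteq> c \<longrightarrow> h b c = 0"
    proof (intro ballI impI)
      fix b c assume bc: "b \<in> B" "c \<in> B" "b \<noteq> c"
      from bc(2) consider i where "i < p" "c = u i" | i where "i < p" "c = v i"
        | i where "i < q" "c = z i" | i where "i < r" "c = e i"
        by (auto simp: B_def)
      then show "h b c = 0"
      proof cases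
        case 1
        then show ?thesis
          using bc(1,3) by (auto simp: B_def hu uv VV ZV EV mem)
      next
        case 2
        then show ?thesis
          using bc(1,3) by (auto simp: B_def hu uv vu UU UZ EU mem)
      next
        case 3
        then show ?thesis
          using bc(1,3) by (auto simp: B_def hz UZ ZV EZ mem) (metis zz(2))
      next
        case 4
        then show ?thesis
          using bc(1,3) by (auto simp: B_def he EU EV EZ mem) (metis ee(2))
      qed
    qed
    ultimately show ?thesis
      by (simp add: orthonormal_set_def B_def)
  qed
  ultimately have sph: "scalar_product h" and pdh: "positive_definite h"
    using orthonormal_basis_scalar_product[OF bilh] by auto
  \<comment> \<open>The involution carries the center \<open>U + Z\<close> into
    \<open>V + Z\<close>, which is \<open>g\<close>-orthogonal to \<open>V + E\<close>; hence
    \<open>V + E\<close> is \<open>h\<close>-orthogonal to the center.\<close>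
  have \<iota>U: "\<iota> x \<in> V" if "x \<in> U" for x
  proof -
    have "\<iota> ` U \<subseteq> V"
      unfolding spans(1)[symmetric] linear_span_image[OF lin, symmetric]
      by (rule span_minimal) (auto simp: \<iota>u mem sub)
    with that show ?thesis
      by blast
  qed
  have \<iota>Z: "\<iota> x \<in> Z" if "x \<in> Z" for x
  proof -
    have "\<iota> ` span (z ` {..<q}) \<subseteq> Z"
      unfolding linear_span_image[OF lin, symmetric]
      by (rule span_minimal) (auto simp: \<iota>z mem sub subspace_scale)
    with that spans(3) show ?thesis
      by blast
  qed
  have hW: "h w c = 0" if w: "w \<in> V + E" and c: "c \<in> C" for w c
  proof -
    obtain a b where a: "w = a + b" "a \<in> V" "b \<in> E"
      using w by (auto simp: set_plus_def)
    obtain s t where s: "c = s + t" "s \<in> U" "t \<in> Z"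
      using c unfolding C_eq[symmetric] by (auto simp: set_plus_def)
    show ?thesis
      using a s \<iota>U[OF s(2)] \<iota>Z[OF s(3)]
      by (simp add: h_def linear_add[OF lin] bilinear_ladd[OF bil] bilinear_radd[OF bil]
          VV ZV EV EZ)
  qed
  have W_eq: "orth_compl h C = V + E"
  proof
    show "V + E \<subseteq> orth_compl h C"
      using hW by (auto simp: orth_compl_def)
    show "orth_compl h C \<subseteq> V + E"
    proof
      fix x assume x: "x \<in> orth_compl h C"
      \<comment> \<open>The central component \<open>c\<close> is \<open>h\<close>-orthogonal to
        \<open>x\<close> and to \<open>w\<close>, hence to itself, so definiteness forces
        \<open>c = 0\<close>.\<close>
      define c where "c = pU x + pZ (y x)"
      define w where "w = pV x + (y x - pZ (y x))"
      have c: "c \<in> C" and w: "w \<in> V + E"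
        unfolding c_def w_def C_eq[symmetric] by (intro set_plus_intro pU pV pZ yE)+
      have xcw: "x = c + w"
        unfolding c_def w_def by (rule decomp)
      have "h c c = h x c - h w c"
        by (simp add: xcw bilinear_ladd[OF bilh])
      also have "\<dots> = 0"
        using x c hW[OF w c] by (simp add: orth_compl_def)
      finally have "c = 0"
        using pdh by (metis less_irrefl positive_definite_def)
      then show "x \<in> V + E"
        using xcw w by simp
    qed
  qed
  have "j_map h br id (V + E) = j_map g br \<iota> (V + E)"
    by (simp add: j_map_def h_def fun_eq_iff)
  then have "H_type_wrt br h"
    using pH unfolding pH_type_wrt_def H_type_wrt_def Let_def U_def[symmetric] Z_def[symmetric]
      E_def[symmetric] C_eq C_def[symmetric] W_eq
    by (simp add: h_def)
  then show ?thesis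
    using sph pdh unfolding H_type_def by blast
qed

section \<open>Finite dimension and the equivalence\<close>

text \<open>A linear left inverse of the isomorphism with the model space is onto, so it sends the
  standard basis to a finite spanning set.\<close>

lemma lie_algebra_of_finite_span:
  fixes G :: "('g, 'm) monoid_scheme" and A :: "('g, 'e::euclidean_space) chart set"
    and br :: "'n::real_vector \<Rightarrow> 'n \<Rightarrow> 'n"
  assumes "lie_algebra_of G A br"
  shows "\<exists>F :: 'n set. finite F \<and> span F = UNIV"
proof -
  obtain T :: "'n \<Rightarrow> 'e" where T: "linear T" "bij T"
    using assms by (auto simp: lie_algebra_of_def)
  then obtain S where S: "linear S" "S \<circ> T = id"
    using linear_injective_left_inverse by (metis bij_is_inj)
  have "span (S ` Basis) = range S"
    by (simp add: linear_span_image[OF S(1)])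
  also have "\<dots> = UNIV"
    using S(2) by (metis comp_apply id_apply surjI)
  finally show ?thesis
    by (metis finite_Basis finite_imageI)
qed

theorem proposition2p10:
  fixes N :: "('g, 'm) monoid_scheme"
    and X :: "'g topology"
    and A :: "('g, 'e::euclidean_space) chart set"
    and br :: "'n::real_vector \<Rightarrow> 'n \<Rightarrow> 'n"
  assumes "lie_group N X A"
    and "connected_space X"
    and "lie_algebra_of N A br"
    and "two_step_nilpotent br"
  shows "H_type br \<longleftrightarrow> pH_type br"
proof
  obtain F :: "'n set" where "finite F" "span F = UNIV"
    using lie_algebra_of_finite_span[OF assms(3)] by blast
  then show "H_type br \<Longrightarrow> pH_type br"
    using H_type_imp_pH_type[OF assms(4)] by blast
  have "bilinear br"
    using assms(4) by (simp add: two_step_nilpotent_def lie_algebra_def)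
  then show "pH_type br \<Longrightarrow> H_type br"
    by (rule pH_type_imp_H_type)
qed

end
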